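(* Let $G$ be a finitely generated just infinite profinite group. Then every element of $G$ of infinite order is a test element of $G$. In particular, if $G$ is moreover torsion free, then every non-trivial element of $G$ is a test element of $G$.
   Context: Subgroups of profinite groups are closed, generation is topological, and homomorphisms are continuous. A profinite group $G$ is just infinite if $G$ is infinite and every proper quotient of $G$ (by a non-trivial closed normal subgroup) is finite. An element $g$ of a profinite group $G$ is a test element of $G$ if every (continuous) endomorphism $\varphi: G\to G$ with $\varphi(g)=g$ is an automorphism. *)

theory Defs
  imports
    "HOL-Algebra.Multiplicative_Group"
    "HOL-Algebra.Generated_Groups"
    "HOL-Analysis.Abstract_Topological_Spaces"
begin

locale topological_group = group G
  for G :: "('a, 'b) monoid_scheme" (structure) and T :: "'a topology" +
  assumes topspace_eq: "topspace T = carrier G"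
    and continuous_mult: "continuous_map (prod_topology T T) T (\<lambda>(x, y). x \<otimes> y)"
    and continuous_inv: "continuous_map T T (\<lambda>x. inv x)"

locale profinite_group = topological_group +
  assumes compact: "compact_space T"
    and hausdorff: "Hausdorff_space T"
    and totally_disconnected: "x \<in> topspace T \<Longrightarrow> connected_component_of_set T x = {x}"

definition topologically_finitely_generated ::
    "('a, 'b) monoid_scheme \<Rightarrow> 'a topology \<Rightarrow> bool" where
  "topologically_finitely_generated G T \<longleftrightarrow>
     (\<exists>S. finite S \<and> S \<subseteq> carrier G \<and> T closure_of (generate G S) = carrier G)"

definition just_infinite :: "('a, 'b) monoid_scheme \<Rightarrow> 'a topology \<Rightarrow> bool" where
  "just_infinite G T \<longleftrightarrow>
     infinite (carrier G) \<and>
     (\<forall>N. N \<lhd> G \<and> closedin T N \<and> N \<noteq> {\<one>\<^bsub>G\<^esub>} \<longrightarrow> finite (carrier (G Mod N)))"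

definition endomorphisms :: "('a, 'b) monoid_scheme \<Rightarrow> 'a topology \<Rightarrow> ('a \<Rightarrow> 'a) set" where
  "endomorphisms G T = {\<phi> \<in> hom G G. continuous_map T T \<phi>}"

definition automorphisms :: "('a, 'b) monoid_scheme \<Rightarrow> 'a topology \<Rightarrow> ('a \<Rightarrow> 'a) set" where
  "automorphisms G T = {\<phi> \<in> iso G G. homeomorphic_map T T \<phi>}"

definition test_element :: "('a, 'b) monoid_scheme \<Rightarrow> 'a topology \<Rightarrow> 'a \<Rightarrow> bool" where
  "test_element G T g \<longleftrightarrow>
     g \<in> carrier G \<and> (\<forall>\<phi> \<in> endomorphisms G T. \<phi> g = g \<longrightarrow> \<phi> \<in> automorphisms G T)"

text \<open>\<^const>\<open>group.ord\<close> takes the value 0 exactly on the elements of infinite order.\<close>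

definition infinite_order :: "('a, 'b) monoid_scheme \<Rightarrow> 'a \<Rightarrow> bool" where
  "infinite_order G g \<longleftrightarrow> group.ord G g = 0"

definition torsion_free :: "('a, 'b) monoid_scheme \<Rightarrow> bool" where
  "torsion_free G \<longleftrightarrow> (\<forall>g \<in> carrier G. g \<noteq> \<one>\<^bsub>G\<^esub> \<longrightarrow> infinite_order G g)"

end

theory Submission
  imports Defs
begin

text \<open>
  Let \<open>\<phi>\<close> be an endomorphism fixing an element \<open>g\<close> of infinite order. The elements \<open>x\<close> with
  \<open>\<phi>\<^sup>t(x) \<rightarrow> \<one>\<close> form a normal subgroup \<open>N\<close>. As \<open>G\<close> is finitely generated, there are only finitely
  many continuous homomorphisms into a given finite quotient \<open>G/V\<close>, so the sequence \<open>\<phi>\<^sup>t\<close> is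
  eventually periodic modulo \<open>V\<close>. Hence \<open>N\<close> is closed, and modulo \<open>N\<close> every \<open>x\<close> is a limit of
  elements \<open>\<phi>\<^sup>m(x)\<close> with \<open>m > 0\<close>. If \<open>N\<close> were non-trivial, it would have finite index and so would
  contain a power \<open>g\<^sup>k\<close> with \<open>k > 0\<close>, which is impossible since \<open>\<phi>\<close> fixes \<open>g\<^sup>k \<noteq> \<one>\<close>. So \<open>N\<close> is
  trivial, whence \<open>\<phi>\<close> is injective with dense and compact image.
\<close>

section \<open>Compactness arguments in general topology\<close>

text \<open>The complements of the members of \<open>\<C>\<close> cover the compact set
  \<open>topspace X - W\<close>. A finite subcover gives finitely many members whose intersection
  within the space lies in \<open>W\<close>, and directedness puts one member below all of them. It
  is applied to the clopen neighbourhoods of the identity and later to the sets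
  \<open>attracted \<phi> V\<close>.\<close>

lemma compact_space_directed_subset:
  assumes X: "compact_space X" and closed: "\<And>C. C \<in> \<C> \<Longrightarrow> closedin X C" and "\<C> \<noteq> {}"
    and directed: "\<And>C D. C \<in> \<C> \<Longrightarrow> D \<in> \<C> \<Longrightarrow> \<exists>E\<in>\<C>. E \<subseteq> C \<inter> D"
    and W: "openin X W" "\<Inter>\<C> \<subseteq> W"
  shows "\<exists>C\<in>\<C>. C \<subseteq> W"
proof -
  have "compactin X (topspace X - W)"
    using X W(1) by (simp add: closedin_compact_space closedin_diff)
  moreover have "topspace X - W \<subseteq> \<Union>((\<lambda>C. topspace X - C) ` \<C>)"
    using W(2) by blast
  ultimately obtain \<F> where \<F>: "finite \<F>" "\<F> \<subseteq> (\<lambda>C. topspace X - C) ` \<C>" "topspace X - W \<subseteq> \<Union>\<F>"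
    using compactinD[of X "topspace X - W" "(\<lambda>C. topspace X - C) ` \<C>"] closed by blast
  then obtain \<D> where \<D>: "finite \<D>" "\<D> \<subseteq> \<C>" "\<F> = (\<lambda>C. topspace X - C) ` \<D>"
    by (meson finite_subset_image)
  have "\<exists>E\<in>\<C>. E \<subseteq> \<Inter>\<D>"
    using \<D>(1,2)
  proof induction
    case empty
    then show ?case using \<open>\<C> \<noteq> {}\<close> by auto
  next
    case (insert C \<D>)
    then obtain E where "E \<in> \<C>" "E \<subseteq> \<Inter>\<D>" by auto
    then obtain E' where "E' \<in> \<C>" "E' \<subseteq> C \<inter> E"
      using directed insert.prems by blast
    then show ?case using \<open>E \<subseteq> \<Inter>\<D>\<close> by auto
  qed
  then obtain E where E: "E \<in> \<C>" "E \<subseteq> \<Inter>\<D>" by blast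
  moreover have "E \<subseteq> topspace X"
    using closed E(1) closedin_subset by blast
  ultimately have "E \<subseteq> W"
    using \<F>(3) \<D>(3) by blast
  with E(1) show ?thesis by blast
qed

text \<open>A form of the tube lemma: the bad pairs form a closed set, and projecting along the
  compact factor \<open>X\<close> is a closed map. It turns a universal quantifier over a closed set
  into an open condition.\<close>

lemma openin_Ball_compact:
  assumes X: "compact_space X" and f: "continuous_map (prod_topology X Y) Z f"
    and K: "closedin X K" and U: "openin Z U"
  shows "openin Y {y \<in> topspace Y. \<forall>k\<in>K. f (k, y) \<in> U}"
proof -
  let ?C = "{p \<in> K \<times> topspace Y. f p \<in> topspace Z - U}"
  have "closedin (prod_topology X Y) ?C"
    using closedin_continuous_map_preimage_gen[OF f, of "K \<times> topspace Y" "topspace Z - U"] K U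
    by (simp add: closedin_prod_Times_iff closedin_diff)
  then have "closedin Y (snd ` ?C)"
    using closed_map_snd[OF X] by (auto simp: closed_map_def)
  moreover have "{y \<in> topspace Y. \<forall>k\<in>K. f (k, y) \<in> U} = topspace Y - snd ` ?C"
  proof -
    have "f (k, y) \<in> topspace Z" if "k \<in> K" "y \<in> topspace Y" for k y
      using continuous_map_image_subset_topspace[OF f] closedin_subset[OF K] that by auto
    then show ?thesis by (force simp: image_iff)
  qed
  ultimately show ?thesis by (simp add: openin_diff)
qed

section \<open>Cosets, stabilisers, cores and iterates in abstract groups\<close>

lemma (in group) rcoset_eq_iff:
  assumes "subgroup H G" "x \<in> carrier G" "y \<in> carrier G"
  shows "H #> x = H #> y \<longleftrightarrow> x \<otimes> inv y \<in> H"
  by (metis assms is_group rcos_self repr_independence subgroup.rcos_module)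

text \<open>This is the stabiliser of \<open>K\<close> under right translation: the two inclusions
  together say that \<open>K\<close> translated by \<open>h\<close> equals \<open>K\<close>. Stating
  both makes closure under inversion immediate and leaves conditions of the shape required by
  \<open>openin_Ball_compact\<close>.\<close>

lemma (in group) stabilizer_subgroup:
  assumes "K \<subseteq> carrier G"
  shows "subgroup {h \<in> carrier G. \<forall>k\<in>K. k \<otimes> h \<in> K \<and> k \<otimes> inv h \<in> K} G" (is "subgroup ?H G")
proof (rule subgroupI)
  show "?H \<noteq> {}"
    using assms by (auto simp: subset_iff intro!: exI[of _ \<one>])
  fix a b assume a: "a \<in> ?H" and b: "b \<in> ?H"
  show "inv a \<in> ?H" using a by simp
  have "k \<otimes> (a \<otimes> b) \<in> K \<and> k \<otimes> inv (a \<otimes> b) \<in> K" if "k \<in> K" for k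
  proof -
    have "k \<otimes> a \<otimes> b \<in> K \<and> k \<otimes> inv b \<otimes> inv a \<in> K"
      using a b \<open>k \<in> K\<close> by simp
    then show ?thesis
      using a b \<open>k \<in> K\<close> assms by (simp add: m_assoc inv_mult_group subset_iff)
  qed
  then show "a \<otimes> b \<in> ?H" using a b by simp
qed blast

text \<open>The set is the normal core of \<open>H\<close>, the intersection of all its conjugates,
  written with a quantifier over \<open>y\<close> so that compactness can later show it
  open.\<close>

lemma (in group) core_normal:
  assumes "subgroup H G"
  shows "{x \<in> carrier G. \<forall>y\<in>carrier G. y \<otimes> x \<otimes> inv y \<in> H} \<lhd> G" (is "?V \<lhd> G")
proof (rule normal_invI)
  show "subgroup ?V G"
  proof (rule subgroupI)
    show "?V \<noteq> {}"
      using subgroup.one_closed[OF assms] by (auto intro!: exI[of _ \<one>])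
    fix a b assume a: "a \<in> ?V" and b: "b \<in> ?V"
    have "y \<otimes> inv a \<otimes> inv y = inv (y \<otimes> a \<otimes> inv y)" if "y \<in> carrier G" for y
      using that a by (simp add: inv_mult_group m_assoc)
    then show "inv a \<in> ?V"
      using a subgroup.m_inv_closed[OF assms] by simp
    have "y \<otimes> (a \<otimes> b) \<otimes> inv y = (y \<otimes> a \<otimes> inv y) \<otimes> (y \<otimes> b \<otimes> inv y)" if "y \<in> carrier G" for y
    proof -
      have "inv y \<otimes> (y \<otimes> (b \<otimes> inv y)) = b \<otimes> inv y"
        using that b by (simp flip: m_assoc)
      then show ?thesis
        using that a b by (simp add: m_assoc)
    qed
    then show "a \<otimes> b \<in> ?V"
      using a b subgroup.m_closed[OF assms] by simp
  qed blast
  fix x h assume x: "x \<in> carrier G" and h: "h \<in> ?V"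
  have "y \<otimes> (x \<otimes> h \<otimes> inv x) \<otimes> inv y = (y \<otimes> x) \<otimes> h \<otimes> inv (y \<otimes> x)" if "y \<in> carrier G" for y
    using that h x by (simp add: inv_mult_group m_assoc)
  then show "x \<otimes> h \<otimes> inv x \<in> ?V"
    using x h by simp
qed

lemma (in group) funpow_hom:
  assumes "\<phi> \<in> hom G G"
  shows "\<phi> ^^ n \<in> hom G G"
proof (induction n)
  case 0
  show ?case by (simp add: hom_def)
next
  case (Suc n)
  then show ?case
    using assms by (auto simp: hom_def Pi_iff)
qed

lemma continuous_map_funpow:
  "continuous_map X X f \<Longrightarrow> continuous_map X X (f ^^ n)"
proof (induction n)
  case 0
  show ?case by (simp add: id_def)
next
  case (Suc n)
  then show ?case by (metis continuous_map_compose funpow.simps(2))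
qed

section \<open>Continuity of group operations and open subgroups\<close>

context topological_group
begin

lemma continuous_map_mult:
  "continuous_map X T f \<Longrightarrow> continuous_map X T g \<Longrightarrow> continuous_map X T (\<lambda>x. f x \<otimes> g x)"
  using continuous_map_compose[OF continuous_map_pairedI continuous_mult, of X f g]
  by (simp add: comp_def)

lemma continuous_map_inverse:
  "continuous_map X T f \<Longrightarrow> continuous_map X T (\<lambda>x. inv (f x))"
  using continuous_map_compose[OF _ continuous_inv, of X f] by (simp add: comp_def)

lemma continuous_map_const_carrier:
  "c \<in> carrier G \<Longrightarrow> continuous_map X T (\<lambda>x. c)"
  by (simp add: topspace_eq)

lemma openin_rcoset:
  assumes "subgroup V G" "openin T V" "x \<in> carrier G"
  shows "openin T (V #> x)"
proof -
  have "continuous_map T T (\<lambda>y. y \<otimes> inv x)"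
    using assms(3) by (intro continuous_map_mult continuous_map_const_carrier) auto
  then have "openin T {y \<in> topspace T. y \<otimes> inv x \<in> V}"
    using assms(2) by (rule openin_continuous_map_preimage)
  moreover have "{y \<in> topspace T. y \<otimes> inv x \<in> V} = V #> x"
    using assms(1,3) subgroup.rcos_module[OF assms(1) is_group assms(3)]
      r_coset_subset_G[OF subgroup.subset[OF assms(1)] assms(3)]
    by (auto simp: topspace_eq)
  ultimately show ?thesis by simp
qed

text \<open>The complement of \<open>V\<close> is a union of cosets of \<open>V\<close>, each of
  them open.\<close>

lemma open_subgroup_closed:
  assumes "subgroup V G" "openin T V"
  shows "closedin T V"
proof -
  have "\<Union>((\<lambda>x. V #> x) ` (carrier G - V)) = carrier G - V"
  proof (intro equalityI subsetI)
    fix y assume "y \<in> \<Union>((\<lambda>x. V #> x) ` (carrier G - V))"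
    then obtain x where x: "x \<in> carrier G" "x \<notin> V" "y \<in> V #> x" by blast
    have "y \<in> carrier G"
      using x(3) r_coset_subset_G[OF subgroup.subset[OF assms(1)] x(1)] by (rule set_mp[rotated])
    moreover have "y \<notin> V"
    proof
      assume "y \<in> V"
      then have "V #> x = V"
        using repr_independence[OF x(3,1) assms(1)] coset_join2[OF \<open>y \<in> carrier G\<close> assms(1)] by simp
      then show False
        using rcos_self[OF x(1) assms(1)] x(2) by simp
    qed
    ultimately show "y \<in> carrier G - V" by simp
  next
    fix y assume "y \<in> carrier G - V"
    then show "y \<in> \<Union>((\<lambda>x. V #> x) ` (carrier G - V))"
      using rcos_self[OF _ assms(1)] by (intro UN_I[of y]) auto
  qed
  moreover have "openin T (\<Union>((\<lambda>x. V #> x) ` (carrier G - V)))"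
    by (intro openin_Union) (use assms in \<open>auto intro: openin_rcoset\<close>)
  ultimately show ?thesis
    using subgroup.subset[OF assms(1)] by (simp add: closedin_def topspace_eq)
qed

end

section \<open>Open normal subgroups of a profinite group\<close>

context profinite_group
begin

text \<open>The cosets form a disjoint open cover of a compact space, so a finite subcover must
  already contain every coset.\<close>

lemma finite_rcosets:
  assumes "subgroup V G" "openin T V"
  shows "finite (rcosets V)"
proof -
  have "openin T U" if "U \<in> rcosets V" for U
    using that assms openin_rcoset by (auto simp: RCOSETS_def)
  moreover have "topspace T \<subseteq> \<Union>(rcosets V)"
    using rcosets_part_G[OF assms(1)] by (simp add: topspace_eq)
  ultimately obtain \<F> where \<F>: "finite \<F>" "\<F> \<subseteq> rcosets V" "carrier G \<subseteq> \<Union>\<F>"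
    using compact[unfolded compact_space_alt topspace_eq, rule_format, of "rcosets V"]
    by (auto simp: topspace_eq)
  have "rcosets V \<subseteq> \<F>"
  proof
    fix C assume C: "C \<in> rcosets V"
    then obtain x where x: "x \<in> carrier G" "C = V #> x"
      by (auto simp: RCOSETS_def)
    then obtain D where D: "D \<in> \<F>" "x \<in> D" using \<F>(3) by blast
    moreover have "x \<in> C" using x rcos_self[OF _ assms(1)] by simp
    moreover have "D \<in> rcosets V" using D(1) \<F>(2) by blast
    ultimately have "C = D"
      using pairwiseD[OF rcos_disjoint[OF assms(1)] C] unfolding disjnt_iff by metis
    with D show "C \<in> \<F>" by simp
  qed
  with \<F>(1) show ?thesis using finite_subset by blast
qed

text \<open>In a compact Hausdorff space components and quasi-components agree, so total
  disconnectedness makes the clopen neighbourhoods of \<one> intersect in {\<one>}. They are closed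
  under intersection, so compactness places one of them inside \<open>W\<close>.\<close>

lemma clopen_base_one:
  assumes "openin T W" "\<one> \<in> W"
  obtains K where "openin T K" "closedin T K" "\<one> \<in> K" "K \<subseteq> W"
proof -
  let ?C = "{K. closedin T K \<and> openin T K \<and> \<one> \<in> K}"
  have "quasi_component_of T \<one> = connected_component_of T \<one>"
    using compact hausdorff by (intro quasi_eq_connected_component_of) simp
  then have *: "\<Inter>?C = {\<one>}"
    using totally_disconnected[of \<one>] quasi_component_of_set[of T \<one>] by (simp add: topspace_eq)
  have "\<exists>K\<in>?C. K \<subseteq> W"
  proof (rule compact_space_directed_subset[OF compact _ _ _ assms(1)])
    have "topspace T \<in> ?C"
      using one_closed by (simp flip: topspace_eq)
    then show "?C \<noteq> {}" by blast
    show "\<exists>E\<in>?C. E \<subseteq> K \<inter> L" if "K \<in> ?C" "L \<in> ?C" for K L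
    proof
      show "K \<inter> L \<in> ?C"
        using that by (simp add: closedin_Int openin_Int)
    qed simp
    show "\<Inter>?C \<subseteq> W"
      unfolding * using assms(2) by simp
  qed simp
  then obtain K where "K \<in> ?C" "K \<subseteq> W" ..
  with that[of K] show ?thesis by simp
qed

text \<open>Choose a clopen \<open>K\<close> with \<one> in \<open>K\<close> and \<open>K\<close>
  inside \<open>W\<close>. Its translation stabiliser \<open>H\<close> lies in \<open>K\<close>
  because it moves \<one> within \<open>K\<close>, and it is open because \<open>K\<close> is both
  compact and open. The core of \<open>H\<close> is then the desired subgroup.\<close>

lemma open_normal_base:
  assumes "openin T W" "\<one> \<in> W"
  obtains V where "V \<lhd> G" "openin T V" "V \<subseteq> W"
proof -
  obtain K where K: "openin T K" "closedin T K" "\<one> \<in> K" "K \<subseteq> W"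
    using clopen_base_one assms .
  have KG: "K \<subseteq> carrier G"
    using openin_subset[OF K(1)] by (simp add: topspace_eq)
  define H where "H = {h \<in> carrier G. \<forall>k\<in>K. k \<otimes> h \<in> K \<and> k \<otimes> inv h \<in> K}"
  have H: "subgroup H G"
    unfolding H_def using KG by (rule stabilizer_subgroup)
  have "\<one> \<otimes> h \<in> K" "h \<in> carrier G" if "h \<in> H" for h
    using that K(3) unfolding H_def by blast+
  then have HW: "H \<subseteq> W"
    using K(4) by auto
  have "openin T {h \<in> topspace T. \<forall>k\<in>K. k \<otimes> h \<in> K}"
    using openin_Ball_compact[OF compact _ K(2) K(1), of T "\<lambda>p. fst p \<otimes> snd p"]
    by (simp add: continuous_map_mult continuous_map_fst continuous_map_snd)
  moreover have "openin T {h \<in> topspace T. \<forall>k\<in>K. k \<otimes> inv h \<in> K}"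
    using openin_Ball_compact[OF compact _ K(2) K(1), of T "\<lambda>p. fst p \<otimes> inv (snd p)"]
    by (simp add: continuous_map_mult continuous_map_inverse continuous_map_fst continuous_map_snd)
  ultimately have "openin T ({h \<in> topspace T. \<forall>k\<in>K. k \<otimes> h \<in> K} \<inter>
      {h \<in> topspace T. \<forall>k\<in>K. k \<otimes> inv h \<in> K})"
    by (rule openin_Int)
  also have "{h \<in> topspace T. \<forall>k\<in>K. k \<otimes> h \<in> K} \<inter>
      {h \<in> topspace T. \<forall>k\<in>K. k \<otimes> inv h \<in> K} = H"
    unfolding H_def topspace_eq by blast
  finally have openH: "openin T H" .
  define V where "V = {x \<in> carrier G. \<forall>y\<in>carrier G. y \<otimes> x \<otimes> inv y \<in> H}"
  have "V \<lhd> G"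
    unfolding V_def using H by (rule core_normal)
  \<comment> \<open>Here the quantifier over conjugating elements ranges over the whole compact
    group.\<close>
  moreover have "openin T V"
    using openin_Ball_compact[OF compact _ closedin_topspace openH,
        of T "\<lambda>p. fst p \<otimes> snd p \<otimes> inv (fst p)"]
    by (simp add: V_def topspace_eq continuous_map_mult continuous_map_inverse
        continuous_map_fst continuous_map_snd)
  moreover have "V \<subseteq> W"
  proof
    fix x assume "x \<in> V"
    then have "\<one> \<otimes> x \<otimes> inv \<one> \<in> H" "x \<in> carrier G"
      unfolding V_def by blast+
    then show "x \<in> W" using HW by auto
  qed
  ultimately show ?thesis by (rule that)
qed

lemma open_normal_separates_one:
  assumes "x \<in> carrier G" "x \<noteq> \<one>"
  obtains V where "V \<lhd> G" "openin T V" "x \<notin> V"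
proof -
  have "openin T (topspace T - {x})"
    using closedin_Hausdorff_singleton[OF hausdorff, of x] assms(1) topspace_eq
    by (intro openin_diff openin_topspace) simp
  moreover have "\<one> \<in> topspace T - {x}"
    using assms by (simp add: topspace_eq)
  ultimately obtain V where "V \<lhd> G" "openin T V" "V \<subseteq> topspace T - {x}"
    using open_normal_base by blast
  then show ?thesis using that by blast
qed

section \<open>Iterates of an endomorphism modulo an open normal subgroup\<close>

text \<open>Modulo \<open>V\<close> a continuous homomorphism is determined by its values on a
  finite topological generating set, and \<open>G/V\<close> is finite. By pigeonhole two iterates
  agree modulo \<open>V\<close>. The single number \<open>m\<close> serves both as threshold and as
  period.\<close>

lemma funpow_eventually_periodic_mod:
  assumes fg: "topologically_finitely_generated G T"
    and \<phi>: "\<phi> \<in> hom G G" "continuous_map T T \<phi>"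
    and V: "V \<lhd> G" "openin T V"
  obtains m where "m > 0"
    "\<And>t x. t \<ge> m \<Longrightarrow> x \<in> carrier G \<Longrightarrow> V #> (\<phi> ^^ (t + m)) x = V #> (\<phi> ^^ t) x"
proof -
  interpret V: normal V G by fact
  have sub: "subgroup V G" by (rule V.subgroup_axioms)
  have \<phi>_closed: "(\<phi> ^^ n) x \<in> carrier G" if "x \<in> carrier G" for n x
    using funpow_hom[OF \<phi>(1)] that by (rule hom_in_carrier)
  obtain S where S: "finite S" "S \<subseteq> carrier G" "T closure_of (generate G S) = carrier G"
    using fg by (auto simp: topologically_finitely_generated_def)
  \<comment> \<open>Only the residues of the generators are recorded, as extensional functions, so
    that all values of \<open>?r\<close> lie in a finite function space.\<close>
  let ?r = "\<lambda>n. \<lambda>s\<in>S. V #> (\<phi> ^^ n) s"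
  have "range ?r \<subseteq> S \<rightarrow>\<^sub>E rcosets V"
    using S(2) \<phi>_closed rcosetsI[OF V.subset] by auto
  then have "finite (range ?r)"
    using finite_PiE[OF S(1) finite_rcosets[OF sub V(2)]] finite_subset by blast
  then have "\<not> inj ?r"
    using finite_imageD infinite_UNIV_nat by blast
  then obtain a b where ab: "a < b" "?r a = ?r b"
    unfolding inj_def by (metis linorder_neqE_nat)
  \<comment> \<open>The equaliser of the two iterates modulo \<open>V\<close>: a closed subgroup
    containing \<open>S\<close>, hence all of \<open>G\<close>.\<close>
  define E where "E = {x \<in> carrier G. V #> (\<phi> ^^ a) x = V #> (\<phi> ^^ b) x}"
  have "subgroup E G"
  proof (rule subgroupI)
    show "E \<noteq> {}"
      using hom_one[OF funpow_hom[OF \<phi>(1)] is_group is_group] by (auto simp: E_def intro!: exI[of _ \<one>])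
    show "inv x \<in> E" if "x \<in> E" for x
    proof -
      have x: "x \<in> carrier G" using that by (simp add: E_def)
      have "V #> (\<phi> ^^ n) (inv x) = set_inv (V #> (\<phi> ^^ n) x)" for n
        using x \<phi>_closed V.rcos_inv
          group_hom.hom_inv[OF group_hom.intro[OF is_group is_group]] funpow_hom[OF \<phi>(1)]
        by (simp add: group_hom_axioms_def)
      then show ?thesis using that by (simp add: E_def)
    qed
    show "x \<otimes> y \<in> E" if "x \<in> E" "y \<in> E" for x y
    proof -
      have xy: "x \<in> carrier G" "y \<in> carrier G" using that by (auto simp: E_def)
      have "V #> (\<phi> ^^ n) (x \<otimes> y) = (V #> (\<phi> ^^ n) x) <#> (V #> (\<phi> ^^ n) y)" for n
        using xy \<phi>_closed V.rcos_sum hom_mult[OF funpow_hom[OF \<phi>(1)]] by simp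
      then show ?thesis using that xy by (simp add: E_def)
    qed
  qed (auto simp: E_def)
  moreover have "S \<subseteq> E"
  proof
    fix s assume "s \<in> S"
    then show "s \<in> E"
      using fun_cong[OF ab(2), of s] S(2) by (auto simp: E_def)
  qed
  ultimately have "generate G S \<subseteq> E"
    using generate_subgroup_incl by blast
  moreover have "closedin T E"
  proof -
    have "continuous_map T T (\<lambda>x. (\<phi> ^^ a) x \<otimes> inv ((\<phi> ^^ b) x))"
      by (intro continuous_map_mult continuous_map_inverse continuous_map_funpow \<phi>(2))
    then have "closedin T {x \<in> topspace T. (\<phi> ^^ a) x \<otimes> inv ((\<phi> ^^ b) x) \<in> V}"
      using open_subgroup_closed[OF sub V(2)] by (rule closedin_continuous_map_preimage)
    moreover have "{x \<in> topspace T. (\<phi> ^^ a) x \<otimes> inv ((\<phi> ^^ b) x) \<in> V} = E"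
      using rcoset_eq_iff[OF sub] \<phi>_closed by (auto simp: E_def topspace_eq)
    ultimately show ?thesis by simp
  qed
  ultimately have E: "carrier G \<subseteq> E"
    using closure_of_minimal[of "generate G S" E T] S(3) by simp
  define p where "p = b - a"
  have step: "V #> (\<phi> ^^ (t + p)) x = V #> (\<phi> ^^ t) x" if "t \<ge> a" "x \<in> carrier G" for t x
  proof -
    \<comment> \<open>Since \<phi> may fail to preserve \<open>V\<close>, the congruence cannot be
      pushed forward by applying \<phi> to it. Instead it is used at the point
      \<open>(\<phi> ^^ (t - a)) x\<close>.\<close>
    have "(\<phi> ^^ (t - a)) x \<in> E" using E \<phi>_closed that(2) by blast
    moreover have "(\<phi> ^^ a) ((\<phi> ^^ (t - a)) x) = (\<phi> ^^ t) x"
      using that(1) funpow_add[of a "t - a" \<phi>] by simp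
    moreover have "(\<phi> ^^ b) ((\<phi> ^^ (t - a)) x) = (\<phi> ^^ (t + p)) x"
    proof -
      have "b + (t - a) = t + p"
        using that(1) ab(1) by (simp add: p_def)
      then show ?thesis
        using funpow_add[of b "t - a" \<phi>] by simp
    qed
    ultimately show ?thesis by (simp add: E_def)
  qed
  have steps: "V #> (\<phi> ^^ (t + n * p)) x = V #> (\<phi> ^^ t) x" if "t \<ge> a" "x \<in> carrier G" for t n x
  proof (induction n)
    case (Suc n)
    then show ?case using step[of "t + n * p" x] that by (simp add: algebra_simps)
  qed simp
  have "p > 0" using ab(1) by (simp add: p_def)
  \<comment> \<open>The choice \<open>m = Suc a * p\<close> is a multiple of the period beyond
    \<open>a\<close>; the successor keeps it positive even when \<open>a = 0\<close>.\<close>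
  then have "Suc a * 1 \<le> Suc a * p"
    by (intro mult_le_mono2) simp
  show ?thesis
  proof (rule that)
    show "Suc a * p > 0" using \<open>p > 0\<close> by simp
    show "V #> (\<phi> ^^ (t + Suc a * p)) x = V #> (\<phi> ^^ t) x"
      if "Suc a * p \<le> t" "x \<in> carrier G" for t x
      using \<open>Suc a * 1 \<le> Suc a * p\<close> that by (intro steps) simp_all
  qed
qed

section \<open>The contraction subgroup of an endomorphism\<close>

definition attracted :: "('a \<Rightarrow> 'a) \<Rightarrow> 'a set \<Rightarrow> 'a set" where
  "attracted \<phi> V = {x \<in> carrier G. \<forall>\<^sub>F t in sequentially. (\<phi> ^^ t) x \<in> V}"

text \<open>By \<open>open_normal_base\<close>, membership means that \<open>(\<phi> ^^ t) x\<close>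
  converges to \<one>. This is the normal subgroup \<open>N\<close> of the overview.\<close>

definition contracted :: "('a \<Rightarrow> 'a) \<Rightarrow> 'a set" where
  "contracted \<phi> = {x \<in> carrier G. \<forall>V. V \<lhd> G \<and> openin T V \<longrightarrow> x \<in> attracted \<phi> V}"

text \<open>All closure properties hold stage by stage: conjugation by \<open>x\<close> becomes, at
  time \<open>t\<close>, conjugation by \<open>(\<phi> ^^ t) x\<close>, and this preserves the
  normal subgroup \<open>V\<close>.\<close>

lemma attracted_normal:
  assumes \<phi>: "\<phi> \<in> hom G G" and V: "V \<lhd> G"
  shows "attracted \<phi> V \<lhd> G"
proof -
  interpret V: normal V G by fact
  have hom: "group_hom G G (\<phi> ^^ n)" for n
    using funpow_hom[OF \<phi>] by (simp add: group_hom_def group_hom_axioms_def is_group)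
  note hom_simps = group_hom.hom_one[OF hom] group_hom.hom_mult[OF hom] group_hom.hom_inv[OF hom]
    group_hom.hom_closed[OF hom]
  show ?thesis
  proof (rule normal_invI)
    show "subgroup (attracted \<phi> V) G"
    proof (rule subgroupI)
      show "attracted \<phi> V \<noteq> {}"
        using hom_simps(1) by (auto simp: attracted_def intro!: exI[of _ \<one>])
      show "inv x \<in> attracted \<phi> V" if "x \<in> attracted \<phi> V" for x
        using that by (auto simp: attracted_def hom_simps elim!: eventually_mono)
      show "x \<otimes> y \<in> attracted \<phi> V" if "x \<in> attracted \<phi> V" "y \<in> attracted \<phi> V" for x y
      proof -
        have "\<forall>\<^sub>F t in sequentially. (\<phi> ^^ t) x \<in> V \<and> (\<phi> ^^ t) y \<in> V"
          using that by (simp add: attracted_def eventually_conj_iff)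
        then show ?thesis
          using that by (auto simp: attracted_def hom_simps elim: eventually_mono)
      qed
    qed (auto simp: attracted_def)
    show "x \<otimes> h \<otimes> inv x \<in> attracted \<phi> V" if "x \<in> carrier G" "h \<in> attracted \<phi> V" for x h
      using that by (auto simp: attracted_def hom_simps V.inv_op_closed2 elim!: eventually_mono)
  qed
qed

text \<open>This guards against the intersection of an empty family, which would be the whole type
  instead of \<open>carrier G\<close>.\<close>

lemma attracted_family_nonempty: "{attracted \<phi> V |V. V \<lhd> G \<and> openin T V} \<noteq> {}"
proof -
  have "carrier G \<lhd> G" "openin T (carrier G)"
    using normal_invI[OF subgroup_self] openin_topspace[of T] by (auto simp: topspace_eq)
  then show ?thesis by blast
qed

lemma contracted_eq_Inter:
  "contracted \<phi> = \<Inter>{attracted \<phi> V |V. V \<lhd> G \<and> openin T V}"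
proof -
  have "\<Inter>{attracted \<phi> V |V. V \<lhd> G \<and> openin T V} \<subseteq> carrier G"
    using attracted_family_nonempty[of \<phi>] by (auto simp: attracted_def)
  then show ?thesis
    unfolding contracted_def by blast
qed

lemma contracted_normal:
  assumes "\<phi> \<in> hom G G"
  shows "contracted \<phi> \<lhd> G"
proof (rule normal_invI)
  show "subgroup (contracted \<phi>) G"
    unfolding contracted_eq_Inter
  proof (rule subgroups_Inter[OF _ attracted_family_nonempty])
    fix A assume "A \<in> {attracted \<phi> V |V. V \<lhd> G \<and> openin T V}"
    then show "subgroup A G"
      using attracted_normal[OF assms] normal_imp_subgroup by auto
  qed
  show "x \<otimes> h \<otimes> inv x \<in> contracted \<phi>" if "x \<in> carrier G" "h \<in> contracted \<phi>" for x h
    using that attracted_normal[OF assms] by (auto simp: contracted_def normal.inv_op_closed2)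
qed

text \<open>Eventual periodicity upgrades "for all large \<open>t\<close>" to "for all
  \<open>t \<ge> m\<close>" with \<open>m\<close> independent of \<open>x\<close>. The set thus
  becomes an intersection of closed preimages of \<open>V\<close>.\<close>

lemma attracted_closed:
  assumes fg: "topologically_finitely_generated G T"
    and \<phi>: "\<phi> \<in> hom G G" "continuous_map T T \<phi>"
    and V: "V \<lhd> G" "openin T V"
  shows "closedin T (attracted \<phi> V)"
proof -
  have sub: "subgroup V G" using V(1) normal_imp_subgroup by blast
  have \<phi>_closed: "(\<phi> ^^ n) x \<in> carrier G" if "x \<in> carrier G" for n x
    using funpow_hom[OF \<phi>(1)] that by (rule hom_in_carrier)
  obtain m where m: "m > 0"
    "\<And>t x. t \<ge> m \<Longrightarrow> x \<in> carrier G \<Longrightarrow> V #> (\<phi> ^^ (t + m)) x = V #> (\<phi> ^^ t) x"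
    using funpow_eventually_periodic_mod[OF assms] by blast
  have mem_iff: "y \<in> V \<longleftrightarrow> V #> y = V" if "y \<in> carrier G" for y
    using that sub coset_join1 coset_join2 subgroup.subset rcos_self by metis
  have periodic: "(\<phi> ^^ (t + n * m)) x \<in> V \<longleftrightarrow> (\<phi> ^^ t) x \<in> V"
    if "t \<ge> m" "x \<in> carrier G" for t n x
  proof (induction n)
    case (Suc n)
    then show ?case
      using m(2)[of "t + n * m" x] that mem_iff \<phi>_closed by (simp add: algebra_simps)
  qed simp
  have "attracted \<phi> V = (\<Inter>t\<in>{m..}. {x \<in> topspace T. (\<phi> ^^ t) x \<in> V})"
  proof (intro equalityI subsetI INT_I CollectI conjI)
    fix x t assume x: "x \<in> attracted \<phi> V" and t: "t \<in> {m..}"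
    show "x \<in> topspace T" using x by (simp add: attracted_def topspace_eq)
    obtain c where c: "\<And>s. s \<ge> c \<Longrightarrow> (\<phi> ^^ s) x \<in> V"
      using x by (auto simp: attracted_def eventually_sequentially)
    \<comment> \<open>Shifting \<open>t\<close> by \<open>c\<close> whole periods moves it past the
      bound \<open>c\<close> without changing membership in \<open>V\<close>.\<close>
    have "t + c * m \<ge> c" using m(1) by (simp add: trans_le_add2)
    then show "(\<phi> ^^ t) x \<in> V"
      using c periodic x t by (auto simp: attracted_def)
  qed (auto simp: attracted_def topspace_eq eventually_sequentially)
  moreover have "closedin T {x \<in> topspace T. (\<phi> ^^ t) x \<in> V}" for t
    using continuous_map_funpow[OF \<phi>(2)] open_subgroup_closed[OF sub V(2)]
    by (rule closedin_continuous_map_preimage)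
  ultimately show ?thesis by auto
qed

lemma contracted_closed:
  assumes "topologically_finitely_generated G T" "\<phi> \<in> hom G G" "continuous_map T T \<phi>"
  shows "closedin T (contracted \<phi>)"
  unfolding contracted_eq_Inter
  using attracted_closed[OF assms] attracted_family_nonempty by (intro closedin_Inter) auto

text \<open>The orbit of a fixed point is constant, so it can enter every open normal subgroup only
  if \<open>x\<close> lies in all of them, and these separate \<open>x\<close> from \<one>.\<close>

lemma fixed_contracted_eq_one:
  assumes "x \<in> contracted \<phi>" "\<phi> x = x"
  shows "x = \<one>"
proof (rule ccontr)
  assume "x \<noteq> \<one>"
  moreover have x: "x \<in> carrier G" using assms(1) by (simp add: contracted_def)
  ultimately obtain V where "V \<lhd> G" "openin T V" "x \<notin> V"
    using open_normal_separates_one by blast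
  moreover have "(\<phi> ^^ t) x = x" for t
    using assms(2) by (induction t) auto
  ultimately show False
    using assms(1) by (auto simp: contracted_def attracted_def)
qed

section \<open>Bijectivity when the contraction subgroup is trivial\<close>

text \<open>A point \<open>x\<close> outside the closed image keeps a neighbourhood away from it.
  Compactness makes some \<open>attracted \<phi> V\<close> so small that dividing \<open>x\<close>
  by its elements stays outside the image, while periodicity modulo \<open>V\<close> shows that one
  such quotient is an iterate of \<open>x\<close>.\<close>

lemma surj_of_contracted_trivial:
  assumes fg: "topologically_finitely_generated G T"
    and \<phi>: "\<phi> \<in> hom G G" "continuous_map T T \<phi>"
    and triv: "contracted \<phi> = {\<one>}"
  shows "\<phi> ` carrier G = carrier G"
proof (rule ccontr)
  have \<phi>_closed: "(\<phi> ^^ n) x \<in> carrier G" if "x \<in> carrier G" for n x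
    using funpow_hom[OF \<phi>(1)] that by (rule hom_in_carrier)
  assume "\<phi> ` carrier G \<noteq> carrier G"
  then obtain x where x: "x \<in> carrier G" "x \<notin> \<phi> ` carrier G"
    using hom_in_carrier[OF \<phi>(1)] by blast
  have "closedin T (\<phi> ` topspace T)"
    using continuous_imp_closed_map[OF \<phi>(2) compact hausdorff] by (auto simp: closed_map_def)
  then have "openin T (topspace T - \<phi> ` topspace T)"
    by (simp add: openin_diff)
  moreover have "continuous_map T T (\<lambda>y. inv y \<otimes> x)"
    using x(1) by (intro continuous_map_mult continuous_map_inverse continuous_map_const_carrier) auto
  \<comment> \<open>The neighbourhood of \<one> consisting of those \<open>y\<close> for which
    \<open>inv y \<otimes> x\<close> still misses the image.\<close>
  ultimately have W: "openin T {y \<in> topspace T. inv y \<otimes> x \<in> topspace T - \<phi> ` topspace T}" (is "openin T ?W")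
    by (rule openin_continuous_map_preimage[rotated])
  have "\<one> \<in> ?W"
    using x by (simp add: topspace_eq)
  let ?C = "{attracted \<phi> V |V. V \<lhd> G \<and> openin T V}"
  have "\<exists>A\<in>?C. A \<subseteq> ?W"
  proof (rule compact_space_directed_subset[OF compact _ _ _ W])
    show "?C \<noteq> {}"
      by (rule attracted_family_nonempty)
    show "closedin T A" if "A \<in> ?C" for A
      using that attracted_closed[OF fg \<phi>] by auto
    show "\<Inter>?C \<subseteq> ?W"
      using triv \<open>\<one> \<in> ?W\<close> contracted_eq_Inter by auto
    show "\<exists>E\<in>?C. E \<subseteq> A \<inter> B" if "A \<in> ?C" "B \<in> ?C" for A B
    proof -
      obtain U V where UV: "A = attracted \<phi> U" "U \<lhd> G" "openin T U" "B = attracted \<phi> V" "V \<lhd> G" "openin T V"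
        using \<open>A \<in> ?C\<close> \<open>B \<in> ?C\<close> by blast
      then have "U \<inter> V \<lhd> G" "openin T (U \<inter> V)"
        using normal_subgroup_intersect by auto
      moreover have "attracted \<phi> (U \<inter> V) \<subseteq> A \<inter> B"
        using UV(1,4) by (auto simp: attracted_def elim: eventually_mono)
      ultimately show ?thesis by blast
    qed
  qed
  then obtain V where V: "V \<lhd> G" "openin T V" and VW: "attracted \<phi> V \<subseteq> ?W" by blast
  have sub: "subgroup V G" using V(1) normal_imp_subgroup by blast
  obtain m where m: "m > 0"
    "\<And>t x. t \<ge> m \<Longrightarrow> x \<in> carrier G \<Longrightarrow> V #> (\<phi> ^^ (t + m)) x = V #> (\<phi> ^^ t) x"
    using funpow_eventually_periodic_mod[OF fg \<phi> V] by blast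
  \<comment> \<open>Chosen so that \<open>inv y \<otimes> x\<close> is
    \<open>(\<phi> ^^ m) x\<close>; periodicity says exactly that \<open>(\<phi> ^^ t) y\<close>
    lies in \<open>V\<close> once \<open>t \<ge> m\<close>.\<close>
  define y where "y = x \<otimes> inv ((\<phi> ^^ m) x)"
  have y: "y \<in> carrier G" using x \<phi>_closed by (simp add: y_def)
  have "(\<phi> ^^ t) y \<in> V" if "t \<ge> m" for t
  proof -
    have "(\<phi> ^^ t) y = (\<phi> ^^ t) x \<otimes> inv ((\<phi> ^^ t) ((\<phi> ^^ m) x))"
      using x \<phi>_closed funpow_hom[OF \<phi>(1)] group_hom.hom_inv[OF group_hom.intro[OF is_group is_group]]
      by (simp add: y_def hom_mult group_hom_axioms_def)
    also have "\<dots> = (\<phi> ^^ t) x \<otimes> inv ((\<phi> ^^ (t + m)) x)"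
      by (simp add: funpow_add)
    finally show ?thesis
      using rcoset_eq_iff[OF sub \<phi>_closed[OF x(1)] \<phi>_closed[OF x(1)], of t "t + m"]
        m(2)[OF that x(1)] by simp
  qed
  then have "y \<in> attracted \<phi> V"
    using y by (auto simp: attracted_def eventually_sequentially)
  then have "inv y \<otimes> x \<notin> \<phi> ` carrier G"
    using VW by (auto simp: topspace_eq)
  moreover have "inv y \<otimes> x = (\<phi> ^^ m) x"
    using x \<phi>_closed by (simp add: y_def inv_mult_group m_assoc)
  \<comment> \<open>Positivity of \<open>m\<close> is what places this iterate in the image of
    \<phi>.\<close>
  moreover have "(\<phi> ^^ m) x = \<phi> ((\<phi> ^^ (m - 1)) x)"
    using m(1) by (cases m) auto
  moreover have "\<phi> ((\<phi> ^^ (m - 1)) x) \<in> \<phi> ` carrier G"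
    by (intro imageI \<phi>_closed x(1))
  ultimately show False by simp
qed

text \<open>A kernel element is sent to \<one> by every iterate from the first on, so it is
  contracted.\<close>

lemma inj_on_of_contracted_trivial:
  assumes \<phi>: "\<phi> \<in> hom G G" and triv: "contracted \<phi> = {\<one>}"
  shows "inj_on \<phi> (carrier G)"
proof -
  interpret group_hom G G \<phi>
    using \<phi> by unfold_locales
  have "x = \<one>" if x: "x \<in> carrier G" "\<phi> x = \<one>" for x
  proof -
    have power_one: "(\<phi> ^^ t) x = \<one>" if "t \<ge> 1" for t
      using that by (induction t rule: nat_induct_at_least) (simp_all add: x)
    have "\<forall>\<^sub>F t in sequentially. (\<phi> ^^ t) x \<in> V" if "V \<lhd> G" for V
      using power_one subgroup.one_closed[OF normal_imp_subgroup[OF that]]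
      by (intro eventually_sequentiallyI[of 1]) simp
    then have "x \<in> contracted \<phi>"
      using x(1) by (simp add: contracted_def attracted_def)
    then show ?thesis using triv by simp
  qed
  then show ?thesis by (simp add: inj_on_one_iff)
qed

end

section \<open>Powers in subgroups of finite index and the conclusion\<close>

text \<open>The order of the quotient annihilates every coset; finiteness makes it a positive
  exponent.\<close>

lemma (in normal) finite_index_pow_mem:
  assumes "finite (carrier (G Mod H))" "x \<in> carrier G"
  obtains k :: nat where "k > 0" "x [^] k \<in> H"
proof -
  interpret Q: group "G Mod H" by (rule factorgroup_is_group)
  have "H #> x \<in> carrier (G Mod H)"
    using assms(2) by (simp add: carrier_FactGroup)
  then have "(H #> x) [^]\<^bsub>G Mod H\<^esub> order (G Mod H) = H"
    using Q.pow_order_eq_1 by simp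
  then have "x [^] order (G Mod H) \<in> H"
    using FactGroup_pow[OF assms(2)] rcos_self[OF _ subgroup_axioms] assms(2) by (metis nat_pow_closed)
  moreover have "order (G Mod H) > 0"
    using assms(1) Q.order_gt_0_iff_finite by simp
  ultimately show ?thesis using that by blast
qed

lemma (in profinite_group) infinite_order_test_element:
  assumes fg: "topologically_finitely_generated G T" and ji: "just_infinite G T"
    and g: "g \<in> carrier G" "infinite_order G g"
  shows "test_element G T g"
  unfolding test_element_def
proof (intro conjI ballI impI g(1))
  fix \<phi> assume "\<phi> \<in> endomorphisms G T" and fix_g: "\<phi> g = g"
  then have \<phi>: "\<phi> \<in> hom G G" "continuous_map T T \<phi>"
    by (auto simp: endomorphisms_def)
  have triv: "contracted \<phi> = {\<one>}"
  proof (rule ccontr)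
    assume "contracted \<phi> \<noteq> {\<one>}"
    then have "finite (carrier (G Mod contracted \<phi>))"
      using ji contracted_normal[OF \<phi>(1)] contracted_closed[OF fg \<phi>] by (auto simp: just_infinite_def)
    then obtain k :: nat where k: "k > 0" "g [^] k \<in> contracted \<phi>"
      using normal.finite_index_pow_mem[OF contracted_normal[OF \<phi>(1)]] g(1) by blast
    moreover have "\<phi> (g [^] k) = g [^] k"
      using hom_nat_pow[OF \<phi>(1) g(1) is_group is_group] fix_g by simp
    ultimately have "g [^] k = \<one>"
      using fixed_contracted_eq_one by blast
    \<comment> \<open>Infinite order is encoded as \<open>ord\<close> equal to 0, and 0 divides no
      positive \<open>k\<close>.\<close>
    then show False
      using k(1) g pow_eq_id by (auto simp: infinite_order_def)
  qed
  have surj: "\<phi> ` carrier G = carrier G"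
    using surj_of_contracted_trivial[OF fg \<phi> triv] .
  have inj: "inj_on \<phi> (carrier G)"
    using inj_on_of_contracted_trivial[OF \<phi>(1) triv] .
  have "homeomorphic_map T T \<phi>"
    using continuous_imp_homeomorphic_map[OF \<phi>(2) compact hausdorff] surj inj by (simp add: topspace_eq)
  with surj inj \<phi>(1) show "\<phi> \<in> automorphisms G T"
    by (simp add: automorphisms_def iso_def bij_betw_def)
qed

theorem corollary3p7:
  fixes G :: "('a, 'b) monoid_scheme" and T :: "'a topology"
  assumes "profinite_group G T"
    and "topologically_finitely_generated G T"
    and "just_infinite G T"
  shows "(\<forall>g \<in> carrier G. infinite_order G g \<longrightarrow> test_element G T g) \<and>
         (torsion_free G \<longrightarrow> (\<forall>g \<in> carrier G. g \<noteq> \<one>\<^bsub>G\<^esub> \<longrightarrow> test_element G T g))"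
  using profinite_group.infinite_order_test_element[OF assms] by (auto simp: torsion_free_def)

end
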